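(* Let $r,r'\in\mathbb{R}_1=(0,1)$ with $r<r'$, with continued fraction expansions $r=[b_1,b_2,\dots]$, $r'=[b'_1,b'_2,\dots]$, and let $C(r)=C_I(b_1)\,C_{II}(b_2)\,C_I(b_3)\,C_{II}(b_4)\cdots\in A^\omega$ and likewise $C(r')$ (for rational $r$, the expansion is the finite one with an even number of partial denominators, and the encoding is terminated by $C_I(\aleph_0)=0^\omega$). Then $C(r)<C(r')$ in lexicographic order.
   Context: $A=\{0,1\}$, $A^\omega$ infinite binary words; $\overline{w}$ is the bitwise complement of a word $w$. For $b\in\mathbb{N}$ with binary expansion $b=\sum_{k=0}^l b_k2^k$, $l=\lfloor\log_2 b\rfloor$, $C_I(b)=0^l\,1\,\overline{b_{l-1}}\cdots\overline{b_0}$ and $C_{II}(b)=\overline{C_I(b)}=1^l\,0\,b_{l-1}\cdots b_0$; $C_I(\aleph_0)=0^\omega$. Continued fraction expansion of $r\in(0,1)$: $r=\cfrac{1}{b_1+\cfrac{1}{b_2+\cdots}}$ with partial denominators $b_i\in\mathbb{N}$, infinite for irrational $r$; a rational $r\in(0,1)$ is written with the unique finite expansion $[b_1,\dots,b_{2l}]$ of even length (using $[\dots,b_m]=[\dots,b_m-1,1]$). *)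

theory Defs
  imports Complex_Main "HOL-Library.Stream" "HOL-Library.Fun_Lexorder"
begin

text \<open>
  The alphabet \<open>{0, 1}\<close> is \<^typ>\<open>bool\<close>, with \<^term>\<open>False\<close> for \<open>0\<close>, \<^term>\<open>True\<close> for \<open>1\<close>, and the
  library order \<^prop>\<open>False < True\<close>; infinite words are streams.
\<close>

text \<open>
  The binary digit \<open>b\<^sub>k\<close> is \<^term>\<open>bit b k\<close>. Only meaningful for \<^prop>\<open>0 < b\<close>.
\<close>

definition C_I :: "nat \<Rightarrow> bool list" where
  "C_I b = (let l = nat \<lfloor>log 2 (real b)\<rfloor>
            in replicate l False @ [True] @ map (\<lambda>k. \<not> bit b k) (rev [0..<l]))"

definition C_II :: "nat \<Rightarrow> bool list" where
  "C_II b = map Not (C_I b)"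

lemma C_II_eq:
  "C_II b = (let l = nat \<lfloor>log 2 (real b)\<rfloor>
             in replicate l True @ [False] @ map (bit b) (rev [0..<l]))"
  by (simp add: C_II_def C_I_def Let_def)

definition C_I_aleph0 :: "bool stream" where
  "C_I_aleph0 = sconst False"

text \<open>Partial denominators are indexed from \<open>0\<close> here, so the blocks at even indices use \<^const>\<open>C_I\<close>.\<close>

definition code_block :: "(nat \<Rightarrow> nat) \<Rightarrow> nat \<Rightarrow> bool list" where
  "code_block b i = (if even i then C_I (b i) else C_II (b i))"

fun cf_value :: "nat list \<Rightarrow> real" where
  "cf_value [] = 0"
| "cf_value (b # bs) = 1 / (real b + cf_value bs)"

definition even_cf_expansion :: "real \<Rightarrow> nat list \<Rightarrow> bool" where
  "even_cf_expansion r bs \<longleftrightarrow> (\<forall>b\<in>set bs. 0 < b) \<and> even (length bs) \<and> cf_value bs = r"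

definition infinite_cf_expansion :: "real \<Rightarrow> (nat \<Rightarrow> nat) \<Rightarrow> bool" where
  "infinite_cf_expansion r b \<longleftrightarrow>
     (\<forall>i. 0 < b i) \<and> (\<lambda>n. cf_value (map b [0..<n])) \<longlonglongrightarrow> r"

definition encode_finite :: "nat list \<Rightarrow> bool stream" where
  "encode_finite bs = concat (map (code_block ((!) bs)) [0..<length bs]) @- C_I_aleph0"

definition encode_infinite :: "(nat \<Rightarrow> nat) \<Rightarrow> bool stream" where
  "encode_infinite b = flat (smap (code_block b) nats)"

text \<open>
  For \<open>r\<close> in the open unit interval both descriptions determine a unique object: the expansion of
  even length if \<open>r\<close> is rational, the infinite expansion if \<open>r\<close> is irrational.
\<close>

definition C :: "real \<Rightarrow> bool stream" where
  "C r = (if r \<in> \<rat> then encode_finite (THE bs. even_cf_expansion r bs)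
          else encode_infinite (THE b. infinite_cf_expansion r b))"

definition lex_less :: "bool stream \<Rightarrow> bool stream \<Rightarrow> bool" where
  "lex_less v w \<longleftrightarrow> less_fun (snth v) (snth w)"

end

theory Submission
  imports Defs
begin

text \<open>
  Two steps of the expansion write \<open>r \<in> (0, 1)\<close> uniquely as \<open>1 / (b + 1 / (c + u))\<close> with
  \<open>u \<in> [0, 1)\<close>, and then \<open>C r = C_I b \<cdot> C_II c \<cdot> C u\<close>; a rational stops exactly when \<open>u = 0\<close>.
  The value decreases in \<open>b\<close> and, for fixed \<open>b\<close>, increases in \<open>c\<close> and then in \<open>u\<close>, as do the
  codes. The map \<open>u \<mapsto> r\<close> contracts distances by a factor \<open>4\<close>, so two different numbers cannot
  share their blocks forever. The same contraction gives convergence of the infinite expansion.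
\<close>

section \<open>Lexicographic order on streams and on blocks\<close>

lemma lex_less_first_difference: "lex_less (p @- False ## v) (p @- True ## w)"
  unfolding lex_less_def
  by (rule less_funI, rule exI[of _ "length p"]) (auto simp: shift_snth)

lemma lex_less_shift:
  assumes "lex_less v w"
  shows "lex_less (p @- v) (p @- w)"
proof -
  obtain k where k: "v !! k < w !! k" "\<And>j. j < k \<Longrightarrow> v !! j = w !! j"
    using assms unfolding lex_less_def by (auto elim: less_funE)
  show ?thesis
    unfolding lex_less_def
    by (rule less_funI, rule exI[of _ "length p + k"]) (use k in \<open>auto simp: shift_snth\<close>)
qed

text \<open>The deciding position lies inside both lists, so neither is a prefix of the other. This
  is stronger than the usual lexicographic order on lists and makes the comparison survive arbitrary
  continuations.\<close>

definition list_lex_less :: "bool list \<Rightarrow> bool list \<Rightarrow> bool" where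
  "list_lex_less xs ys \<longleftrightarrow> (\<exists>p x y. xs = p @ False # x \<and> ys = p @ True # y)"

lemma list_lex_less_shift:
  "list_lex_less xs ys \<Longrightarrow> lex_less (xs @- v) (ys @- w)"
  unfolding list_lex_less_def by (auto simp: lex_less_first_difference)

lemma list_lex_less_append:
  "list_lex_less xs ys \<Longrightarrow> list_lex_less (p @ xs) (p @ ys)"
  unfolding list_lex_less_def by (metis append.assoc)

lemma list_lex_less_complement:
  assumes "list_lex_less xs ys"
  shows "list_lex_less (map Not ys) (map Not xs)"
proof -
  obtain p x y where "xs = p @ False # x" "ys = p @ True # y"
    using assms unfolding list_lex_less_def by blast
  then have "map Not ys = map Not p @ False # map Not y" "map Not xs = map Not p @ True # map Not x"
    by auto
  then show ?thesis unfolding list_lex_less_def by blast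
qed

section \<open>Monotonicity of the block codes\<close>

lemma bits_list_lex_less:
  fixes a b :: nat
  assumes "take_bit l a < take_bit l b"
  shows "list_lex_less (map (bit a) (rev [0..<l])) (map (bit b) (rev [0..<l]))"
  using assms
proof (induction l)
  case 0
  then show ?case by simp
next
  case (Suc l)
  have lt: "take_bit l a < 2 ^ l" "take_bit l b < 2 ^ l" by simp_all
  \<comment> \<open>The remaining combination, \<open>bit a l\<close> without
    \<open>bit b l\<close>, is impossible: the top bit adds \<open>2 ^ l\<close> on the left, which
    exceeds \<open>take_bit l b\<close>.\<close>
  consider "bit a l = bit b l" "take_bit l a < take_bit l b" | "\<not> bit a l" "bit b l"
    using Suc.prems lt by (cases "bit a l"; cases "bit b l") (auto simp: take_bit_Suc_from_most)
  then show ?case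
  proof cases
    case 1
    then show ?thesis using list_lex_less_append[OF Suc.IH, of "[bit b l]"] by simp
  next
    case 2
    then have "map (bit a) (rev [0..<Suc l]) = [] @ False # map (bit a) (rev [0..<l])"
      "map (bit b) (rev [0..<Suc l]) = [] @ True # map (bit b) (rev [0..<l])"
      by simp_all
    then show ?thesis unfolding list_lex_less_def by blast
  qed
qed

text \<open>If \<open>b\<close> has more binary digits than \<open>a\<close>, its code has more
  leading zeros and is smaller. With equally many digits the prefixes coincide, and complementing
  the remaining digits reverses the numerical order.\<close>

lemma C_I_strict_antimono:
  assumes "0 < a" "a < b"
  shows "list_lex_less (C_I b) (C_I a)"
proof -
  define k where "k = nat \<lfloor>log 2 (real a)\<rfloor>"
  define l where "l = nat \<lfloor>log 2 (real b)\<rfloor>"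
  have "log 2 (real a) \<le> log 2 (real b)" "0 \<le> log 2 (real a)" using assms by auto
  then have kl: "k \<le> l" unfolding k_def l_def by (intro nat_mono floor_mono)
  have bounds: "2 ^ nat \<lfloor>log 2 (real n)\<rfloor> \<le> n \<and> n < 2 ^ Suc (nat \<lfloor>log 2 (real n)\<rfloor>)"
    if "0 < n" for n :: nat
  proof -
    have "0 \<le> \<lfloor>log 2 (real n)\<rfloor>" using that by simp
    then have "\<lfloor>log 2 (real n)\<rfloor> = int (nat \<lfloor>log 2 (real n)\<rfloor>)" by simp
    then show ?thesis using floor_log_nat_eq_powr_iff[of 2 n "nat \<lfloor>log 2 (real n)\<rfloor>"] that by simp
  qed
  show ?thesis
  proof (cases "k = l")
    case True
    \<comment> \<open>Both numbers have leading digit 1 at position \<open>l\<close>, so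
      \<open>a < b\<close> is decided by the digits below it.\<close>
    have "a div 2 ^ l = 1" "b div 2 ^ l = 1"
      using bounds[of a] bounds[of b] assms True unfolding k_def[symmetric] l_def[symmetric]
      by (auto intro!: div_nat_eqI)
    then have "take_bit l a < take_bit l b"
      using assms(2) div_mult_mod_eq[of a "2 ^ l"] div_mult_mod_eq[of b "2 ^ l"]
      by (simp add: take_bit_eq_mod)
    from list_lex_less_append[OF list_lex_less_complement[OF bits_list_lex_less[OF this]],
        of "replicate l False @ [True]"]
    show ?thesis using True unfolding C_I_def Let_def k_def[symmetric] l_def[symmetric]
      by (simp add: comp_def)
  next
    case False
    then have "k < l" using kl by simp
    then have "replicate l False = replicate k False @ False # replicate (l - Suc k) False"
      by (metis Suc_diff_Suc add_diff_inverse_nat less_imp_not_less replicate_Suc replicate_add)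
    then show ?thesis
      unfolding C_I_def Let_def k_def[symmetric] l_def[symmetric] list_lex_less_def by auto
  qed
qed

lemma C_II_strict_mono:
  "0 < a \<Longrightarrow> a < b \<Longrightarrow> list_lex_less (C_II a) (C_II b)"
  unfolding C_II_def by (intro list_lex_less_complement C_I_strict_antimono)

text \<open>The 1 following the initial zeros of \<open>C_I b\<close> is the first difference. This
  settles the case where the smaller number is exhausted and the larger one still has
  blocks.\<close>

lemma aleph0_lex_less_C_I: "lex_less C_I_aleph0 (C_I b @- w)"
proof -
  define l where "l = nat \<lfloor>log 2 (real b)\<rfloor>"
  have "sconst False = replicate n False @- False ## sconst False" for n
    by (induction n) (simp, metis id_apply siterate.code,
        metis id_apply replicate_Suc shift.simps(2) siterate.code)
  then have aleph0: "C_I_aleph0 = replicate l False @- False ## sconst False"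
    unfolding C_I_aleph0_def by blast
  show ?thesis
    unfolding aleph0 C_I_def Let_def l_def[symmetric] shift_append shift.simps
    by (rule lex_less_first_difference)
qed

section \<open>Unfolding the encodings by two blocks\<close>

lemma C_I_nonempty [simp]: "C_I b \<noteq> []" and C_II_nonempty [simp]: "C_II b \<noteq> []"
  by (simp_all add: C_I_def C_II_def Let_def)

text \<open>A shift by two preserves the parity of indices, hence the alternation of codes. The
  blocks being nonempty lets \<open>flat\<close> release them one after the other.\<close>

lemma encode_infinite_unfold:
  "encode_infinite b = C_I (b 0) @- C_II (b 1) @- encode_infinite (\<lambda>i. b (Suc (Suc i)))"
proof -
  have "smap (code_block b) (fromN 2) = smap (code_block (\<lambda>i. b (Suc (Suc i)))) nats"
    unfolding smap_alt by (simp add: code_block_def)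
  moreover have "smap (code_block b) nats = C_I (b 0) ## C_II (b 1) ## smap (code_block b) (fromN 2)"
    by (subst siterate.code, subst siterate.code) (simp add: code_block_def numeral_2_eq_2)
  ultimately show ?thesis unfolding encode_infinite_def by simp
qed

lemma encode_finite_unfold:
  "encode_finite (b # c # bs) = C_I b @- C_II c @- encode_finite bs"
proof -
  have "[0..<length (b # c # bs)] = 0 # 1 # map (\<lambda>i. Suc (Suc i)) [0..<length bs]"
    by (simp add: upt_conv_Cons map_Suc_upt[symmetric] comp_def del: upt_Suc)
  then show ?thesis
    unfolding encode_finite_def by (simp add: code_block_def[abs_def] comp_def del: upt_Suc cong: if_cong)
qed

section \<open>Two steps of a continued fraction as a map of the remainder\<close>

lemma cf_value_bounds:
  assumes "\<forall>b\<in>set bs. 0 < b"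
  shows "0 \<le> cf_value bs" "cf_value bs \<le> 1"
proof -
  have "0 \<le> cf_value bs \<and> cf_value bs \<le> 1"
    using assms
  proof (induction bs)
    case (Cons b bs)
    then have "1 \<le> real b" by simp
    then show ?case using Cons by (simp add: divide_simps)
  qed simp
  then show "0 \<le> cf_value bs" "cf_value bs \<le> 1" by auto
qed

lemma two_step_bounds:
  fixes u :: real
  assumes "0 < b" "0 < c" "0 \<le> u"
  shows "0 < 1 / (real b + 1 / (real c + u))" "1 / (real b + 1 / (real c + u)) < 1"
proof -
  have "0 < 1 / (real c + u)" "1 \<le> real b" using assms by auto
  then have "1 < real b + 1 / (real c + u)" by linarith
  then show "0 < 1 / (real b + 1 / (real c + u))" "1 / (real b + 1 / (real c + u)) < 1" by simp_all
qed

text \<open>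
  The inner fraction \<open>1 / (c + u)\<close> ranges over \<open>(0, 1]\<close> and \<open>u\<close> over \<open>[0, 1)\<close>, so each
  of \<open>b\<close> and \<open>c\<close> is determined by the value, rationals included.
\<close>

lemma two_step_le_cases:
  fixes u u' :: real
  assumes pos: "0 < b" "0 < c" "0 < b'" "0 < c'"
    and u: "0 \<le> u" "u < 1" and u': "0 \<le> u'" "u' < 1"
    and le: "1 / (real b + 1 / (real c + u)) \<le> 1 / (real b' + 1 / (real c' + u'))"
  shows "b' < b \<or> b = b' \<and> (c < c' \<or> c = c' \<and> u \<le> u')"
proof -
  have t: "0 < 1 / (real c + u)" "1 / (real c + u) \<le> 1" "0 < 1 / (real c' + u')"
    using pos u u' by auto
  have "0 < real b + 1 / (real c + u)" "0 < real b' + 1 / (real c' + u')"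
    using pos t by linarith+
  then have le': "real b' + 1 / (real c' + u') \<le> real b + 1 / (real c + u)"
    using le by (simp add: divide_simps)
  then have "real b' < real b + 1" using t by linarith
  then have "b' \<le> b" by linarith
  moreover have "c < c' \<or> c = c' \<and> u \<le> u'" if "b = b'"
  proof -
    have "1 / (real c' + u') \<le> 1 / (real c + u)" using le' that by simp
    moreover have "0 < real c' + u'" "0 < real c + u" using pos u u' by linarith+
    ultimately have "real c + u \<le> real c' + u'" by (simp add: divide_simps)
    moreover from this have "real c < real c' + 1" using u u' by linarith
    then have "c \<le> c'" by linarith
    ultimately show ?thesis by (cases "c = c'") auto
  qed
  ultimately show ?thesis by linarith
qed

text \<open>Antisymmetry: the comparison is applied in both directions. Both uniqueness proofs for
  expansions rest on this.\<close>

lemma two_step_inject: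
  fixes u u' :: real
  assumes "0 < b" "0 < c" "0 < b'" "0 < c'" "0 \<le> u" "u < 1" "0 \<le> u'" "u' < 1"
    and "1 / (real b + 1 / (real c + u)) = 1 / (real b' + 1 / (real c' + u'))"
  shows "b = b' \<and> c = c' \<and> u = u'"
  using two_step_le_cases[of b c b' c' u u'] two_step_le_cases[of b' c' b c u' u] assms by linarith

text \<open>In \<open>u\<close> the map is a fractional linear transformation of determinant 1, so
  the difference of two values is \<open>u - v\<close> divided by the product of the denominators
  \<open>x\<close> and \<open>y\<close>, each of which is at least 2.\<close>

lemma two_step_contraction:
  fixes u v :: real
  assumes "0 < b" "0 < c" "0 \<le> u" "0 \<le> v"
  shows "\<bar>1 / (real b + 1 / (real c + u)) - 1 / (real b + 1 / (real c + v))\<bar> \<le> \<bar>u - v\<bar> / 4"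
proof -
  define x where "x = real b * (real c + u) + 1"
  define y where "y = real b * (real c + v) + 1"
  have b: "1 \<le> real b" and cu: "1 \<le> real c + u" and cv: "1 \<le> real c + v" using assms by linarith+
  have xy: "2 \<le> x" "2 \<le> y"
    using mult_mono[OF b cu] mult_mono[OF b cv] unfolding x_def y_def by auto
  have frac: "1 / (real b + 1 / (real c + u)) = (real c + u) / x"
    "1 / (real b + 1 / (real c + v)) = (real c + v) / y"
    using cu cv unfolding x_def y_def by (simp_all add: field_simps)
  have "(real c + u) / x - (real c + v) / y = (u - v) / (x * y)"
    using xy by (simp add: diff_frac_eq) (simp add: x_def y_def algebra_simps)
  then have "\<bar>(real c + u) / x - (real c + v) / y\<bar> = \<bar>u - v\<bar> / (x * y)"
    using xy by (simp add: abs_divide)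
  also have "\<dots> \<le> \<bar>u - v\<bar> / 4"
    using mult_mono[OF xy] xy by (intro divide_left_mono) auto
  finally show ?thesis unfolding frac .
qed

section \<open>Even finite expansions of rationals\<close>

lemma even_cf_value_less_one:
  assumes "\<forall>b\<in>set bs. 0 < b" "even (length bs)"
  shows "cf_value bs < 1"
proof (cases bs)
  case (Cons b cs)
  \<comment> \<open>Evenness supplies a second entry, which makes the bound strict; the odd list
    \<open>[1]\<close> has value 1.\<close>
  then obtain c ds where "bs = b # c # ds" using assms(2) by (cases cs) auto
  then show ?thesis using two_step_bounds(2)[of b c "cf_value ds"] assms cf_value_bounds[of ds] by simp
qed simp

text \<open>Entries are removed in pairs, so the tails keep even length and their values stay in the
  interval [0, 1) where \<open>two_step_inject\<close> applies.\<close>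

lemma even_cf_expansion_unique:
  "even_cf_expansion r bs \<Longrightarrow> even_cf_expansion r bs' \<Longrightarrow> bs = bs'"
proof (induction bs arbitrary: r bs' rule: induct_list012)
  case 1
  then have r: "r = 0" by (simp add: even_cf_expansion_def)
  show ?case
  proof (cases bs')
    case (Cons b cs)
    then have "0 < real b" "0 \<le> cf_value cs"
      using 1(2) cf_value_bounds(1)[of cs] by (auto simp: even_cf_expansion_def)
    then have "0 < cf_value bs'" using Cons by simp
    then show ?thesis using 1(2) r by (simp add: even_cf_expansion_def)
  qed simp
next
  case (2 b)
  then show ?case by (simp add: even_cf_expansion_def)
next
  case (3 b c ds)
  have ds: "\<forall>b\<in>set (b # c # ds). 0 < b" "even (length ds)" "r = 1 / (real b + 1 / (real c + cf_value ds))"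
    using "3.prems"(1) by (auto simp: even_cf_expansion_def)
  have "0 < r" using two_step_bounds(1)[of b c "cf_value ds"] cf_value_bounds(1)[of ds] ds by simp
  then have "bs' \<noteq> []" "even (length bs')" using "3.prems"(2) by (auto simp: even_cf_expansion_def)
  then obtain b' c' ds' where bs': "bs' = b' # c' # ds'"
    by (cases bs'; cases "tl bs'") auto
  have ds': "\<forall>b\<in>set (b' # c' # ds'). 0 < b" "even (length ds')" "r = 1 / (real b' + 1 / (real c' + cf_value ds'))"
    using "3.prems"(2) bs' by (auto simp: even_cf_expansion_def)
  have "b = b' \<and> c = c' \<and> cf_value ds = cf_value ds'"
    using ds ds' cf_value_bounds(1)[of ds] cf_value_bounds(1)[of ds']
      even_cf_value_less_one[of ds] even_cf_value_less_one[of ds']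
    by (intro two_step_inject) auto
  moreover from this have "ds = ds'"
    using ds ds' by (intro "3.IH"(1)[of "cf_value ds"]) (auto simp: even_cf_expansion_def)
  ultimately show ?case using bs' by simp
qed

text \<open>The Euclidean algorithm with two divisions per round: \<open>q / p = b + m / p\<close>
  and \<open>p / m = c + n / m\<close>, leaving the fraction \<open>n / m\<close> with smaller
  denominator.\<close>

lemma even_cf_expansion_fraction:
  "p < q \<Longrightarrow> \<exists>bs. even_cf_expansion (real p / real q) bs"
proof (induction q arbitrary: p rule: less_induct)
  case (less q)
  show ?case
  proof (cases "p = 0")
    case True
    then show ?thesis by (intro exI[of _ "[]"]) (simp add: even_cf_expansion_def)
  next
    case False
    \<comment> \<open>Dividing \<open>q - 1\<close> instead of \<open>q\<close> puts the remainder
      \<open>m\<close> between 1 and \<open>p\<close>. If \<open>p\<close> divides \<open>q\<close>,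
      the quotient drops by one and the next digit is 1, which keeps the length even.\<close>
    define b where "b = (q - 1) div p"
    define m where "m = q - b * p"
    have bm: "q - 1 = b * p + (q - 1) mod p" unfolding b_def by simp
    have "(q - 1) mod p < p" using False by simp
    with bm less.prems have m: "q = b * p + m" "0 < m" "m \<le> p" unfolding m_def by linarith+
    have b: "0 < b" unfolding b_def using False less.prems by (simp add: div_greater_zero_iff)
    define c where "c = p div m"
    define n where "n = p mod m"
    have n: "p = c * m + n" "n < m" "0 < c"
      using m unfolding c_def n_def by (simp_all add: div_greater_zero_iff)
    have "m < q" using m less.prems by linarith
    then obtain bs where bs: "even_cf_expansion (real n / real m) bs" using less.IH n(2) by blast
    have "real c + real n / real m = real p / real m"
      using n(1) m(2) by (simp add: field_simps flip: of_nat_mult of_nat_add)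
    moreover have "real b + real m / real p = real q / real p"
      using m(1) False by (simp add: field_simps flip: of_nat_mult of_nat_add)
    ultimately have "even_cf_expansion (real p / real q) (b # c # bs)"
      using bs b n(3) by (simp add: even_cf_expansion_def)
    then show ?thesis by blast
  qed
qed

lemma even_cf_expansion_exists:
  assumes "r \<in> \<rat>" "0 \<le> r" "r < 1"
  shows "\<exists>bs. even_cf_expansion r bs"
proof -
  obtain p q where pq: "q \<noteq> 0" "\<bar>r\<bar> = real p / real q"
    using Rats_abs_nat_div_natE[OF assms(1)] by metis
  then have r: "r = real p / real q" using assms by simp
  then have "p < q" using pq(1) assms(3) by (simp only: divide_less_eq_1) auto
  then show ?thesis unfolding r by (rule even_cf_expansion_fraction)
qed

lemma C_rational:
  assumes "even_cf_expansion r bs" "r \<in> \<rat>"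
  shows "C r = encode_finite bs"
  using assms even_cf_expansion_unique by (auto simp: C_def intro!: arg_cong[of _ _ encode_finite])

text \<open>Zero lies outside the open interval but occurs as the remainder \<open>u\<close> at the
  end of a rational expansion.\<close>

lemma C_zero: "C 0 = C_I_aleph0"
  by (subst C_rational[of _ "[]"]) (simp_all add: even_cf_expansion_def encode_finite_def)

section \<open>Infinite expansions and their uniqueness\<close>

lemma cf_value_map_Suc:
  "cf_value (map g [0..<Suc n]) = 1 / (real (g 0) + cf_value (map (\<lambda>i. g (Suc i)) [0..<n]))"
  by (simp add: upt_conv_Cons map_Suc_upt[symmetric] comp_def del: upt_Suc)

text \<open>Inverting the recursion for the convergents of \<open>r\<close> shows that those of the
  shifted sequence tend to \<open>1 / r - real (g 0)\<close>, which serves as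
  \<open>t\<close>.\<close>

lemma infinite_cf_expansion_tail:
  assumes r: "r \<notin> \<rat>" and g: "infinite_cf_expansion r g"
  obtains t where "t \<notin> \<rat>" "0 \<le> t" "t < 1" "r = 1 / (real (g 0) + t)"
    "infinite_cf_expansion t (\<lambda>i. g (Suc i))"
proof
  let ?v = "\<lambda>n. cf_value (map (\<lambda>i. g (Suc i)) [0..<n])"
  have pos: "0 < g i" for i using g by (simp add: infinite_cf_expansion_def)
  have r0: "r \<noteq> 0" using r by auto
  have "(\<lambda>n. cf_value (map g [0..<Suc n])) \<longlonglongrightarrow> r"
    using g unfolding infinite_cf_expansion_def by (intro LIMSEQ_Suc) blast
  then have "(\<lambda>n. 1 / (real (g 0) + ?v n)) \<longlonglongrightarrow> r" unfolding cf_value_map_Suc .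
  then have "(\<lambda>n. 1 / (1 / (real (g 0) + ?v n)) - real (g 0)) \<longlonglongrightarrow> 1 / r - real (g 0)"
    using r0 by (intro tendsto_intros)
  then have lim: "?v \<longlonglongrightarrow> 1 / r - real (g 0)" by simp
  then show "infinite_cf_expansion (1 / r - real (g 0)) (\<lambda>i. g (Suc i))"
    using pos by (simp add: infinite_cf_expansion_def)
  show "r = 1 / (real (g 0) + (1 / r - real (g 0)))" by simp
  show irr: "1 / r - real (g 0) \<notin> \<rat>"
  proof
    assume "1 / r - real (g 0) \<in> \<rat>"
    then have "1 / (1 / r - real (g 0) + real (g 0)) \<in> \<rat>" by (intro Rats_divide Rats_add) auto
    then show False using r by simp
  qed
  \<comment> \<open>The limit inherits only the closed bounds; the value 1 is excluded by
    irrationality.\<close>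
  have "0 \<le> ?v n" "?v n \<le> 1" for n using cf_value_bounds pos by auto
  then have "0 \<le> 1 / r - real (g 0)" "1 / r - real (g 0) \<le> 1"
    by (blast intro: LIMSEQ_le_const[OF lim] LIMSEQ_le_const2[OF lim])+
  moreover have "1 / r - real (g 0) \<noteq> 1" using irr by (metis Rats_1)
  ultimately show "0 \<le> 1 / r - real (g 0)" "1 / r - real (g 0) < 1" by linarith+
qed

lemma infinite_cf_expansion_two_step:
  assumes r: "r \<notin> \<rat>" and g: "infinite_cf_expansion r g"
  obtains u where "u \<notin> \<rat>" "0 \<le> u" "u < 1" "r = 1 / (real (g 0) + 1 / (real (g 1) + u))"
    "infinite_cf_expansion u (\<lambda>i. g (Suc (Suc i)))"
proof -
  obtain t where t: "t \<notin> \<rat>" "r = 1 / (real (g 0) + t)" "infinite_cf_expansion t (\<lambda>i. g (Suc i))"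
    using infinite_cf_expansion_tail[OF r g] .
  show ?thesis
    by (rule infinite_cf_expansion_tail[OF t(1,3)]) (use t(2) that in simp)
qed

lemma infinite_cf_expansion_unique:
  assumes "r \<notin> \<rat>" "infinite_cf_expansion r g" "infinite_cf_expansion r h"
  shows "g = h"
proof
  fix i
  \<comment> \<open>Stated for fresh \<open>r\<close>, \<open>g\<close>, \<open>h\<close>, because
    the induction below passes to the common remainder and the shifted sequences.\<close>
  have step: "g 0 = h 0 \<and> g 1 = h 1 \<and> (\<exists>u. u \<notin> \<rat> \<and>
      infinite_cf_expansion u (\<lambda>i. g (Suc (Suc i))) \<and> infinite_cf_expansion u (\<lambda>i. h (Suc (Suc i))))"
    if r: "r \<notin> \<rat>" and g: "infinite_cf_expansion r g" and h: "infinite_cf_expansion r h" for r g h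
  proof -
    obtain u where u: "u \<notin> \<rat>" "0 \<le> u" "u < 1" "r = 1 / (real (g 0) + 1 / (real (g 1) + u))"
      "infinite_cf_expansion u (\<lambda>i. g (Suc (Suc i)))"
      using infinite_cf_expansion_two_step[OF r g] .
    obtain v where v: "0 \<le> v" "v < 1" "r = 1 / (real (h 0) + 1 / (real (h 1) + v))"
      "infinite_cf_expansion v (\<lambda>i. h (Suc (Suc i)))"
      using infinite_cf_expansion_two_step[OF r h] .
    have "g 0 = h 0 \<and> g 1 = h 1 \<and> u = v"
      using g h u v by (intro two_step_inject) (auto simp: infinite_cf_expansion_def)
    then show ?thesis using u v by blast
  qed
  show "g i = h i"
    using assms
  proof (induction i arbitrary: r g h rule: induct_nat_012)
    case 0
    then show ?case using step by blast
  next
    case 1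
    then show ?case using step by (metis One_nat_def)
  next
    case (ge2 n)
    obtain u where "u \<notin> \<rat>" "infinite_cf_expansion u (\<lambda>i. g (Suc (Suc i)))"
      "infinite_cf_expansion u (\<lambda>i. h (Suc (Suc i)))"
      using step[OF ge2.prems] by blast
    then show ?case by (rule ge2.IH(1))
  qed
qed

section \<open>Existence of infinite expansions by the Gauss map\<close>

fun gauss_iterate :: "real \<Rightarrow> nat \<Rightarrow> real" where
  "gauss_iterate r 0 = r"
| "gauss_iterate r (Suc n) = gauss_iterate (frac (1 / r)) n"

definition gauss_digit :: "real \<Rightarrow> nat \<Rightarrow> nat" where
  "gauss_digit r n = nat \<lfloor>1 / gauss_iterate r n\<rfloor>"

lemma gauss_digit_Suc: "gauss_digit r (Suc n) = gauss_digit (frac (1 / r)) n"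
  by (simp add: gauss_digit_def)

lemma gauss_map:
  assumes "r \<notin> \<rat>" "0 < r" "r < 1"
  shows "frac (1 / r) \<notin> \<rat>" "0 < frac (1 / r)" "frac (1 / r) < 1"
    "0 < gauss_digit r 0" "r = 1 / (real (gauss_digit r 0) + frac (1 / r))"
proof -
  have "1 < 1 / r" using assms by simp
  then have fl: "1 \<le> \<lfloor>1 / r\<rfloor>" by simp
  then show "0 < gauss_digit r 0" by (simp add: gauss_digit_def)
  have "real (gauss_digit r 0) + frac (1 / r) = 1 / r"
    using fl by (simp add: gauss_digit_def frac_def del: one_le_floor)
  then show eq: "r = 1 / (real (gauss_digit r 0) + frac (1 / r))" by simp
  show irr: "frac (1 / r) \<notin> \<rat>"
  proof
    assume "frac (1 / r) \<in> \<rat>"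
    then have "1 / (real (gauss_digit r 0) + frac (1 / r)) \<in> \<rat>"
      by (intro Rats_divide Rats_add) auto
    then show False using assms(1) eq by simp
  qed
  show "frac (1 / r) < 1" by (rule frac_lt_1)
  have "frac (1 / r) \<noteq> 0" using irr by (metis Rats_0)
  then show "0 < frac (1 / r)" using frac_ge_0[of "1 / r"] by linarith
qed

lemma gauss_digit_pos:
  "r \<notin> \<rat> \<Longrightarrow> 0 < r \<Longrightarrow> r < 1 \<Longrightarrow> 0 < gauss_digit r n"
proof (induction n arbitrary: r)
  case (Suc n)
  then show ?case unfolding gauss_digit_Suc by (intro Suc.IH gauss_map) auto
qed (rule gauss_map)

text \<open>Two digits shrink the error by a factor 4, hence the rate 1/2 per digit.\<close>

lemma gauss_digit_convergent_bound:
  assumes "r \<notin> \<rat>" "0 < r" "r < 1"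
  shows "\<bar>r - cf_value (map (gauss_digit r) [0..<n])\<bar> \<le> 2 * (1 / 2) ^ n"
  using assms
proof (induction n arbitrary: r rule: induct_nat_012)
  case 0
  then show ?case by simp
next
  case 1
  \<comment> \<open>For one digit the bound equals 1, and both numbers lie in [0, 1]; the factor 2
    in the statement is chosen for this case.\<close>
  have "0 \<le> cf_value (map (gauss_digit r) [0..<Suc 0])" "cf_value (map (gauss_digit r) [0..<Suc 0]) \<le> 1"
    using cf_value_bounds[of "[gauss_digit r 0]"] gauss_digit_pos[OF 1, of 0] by simp_all
  then show ?case using 1 by (simp only: power_one_right One_nat_def[symmetric])
next
  case (ge2 n)
  define t where "t = frac (1 / r)"
  define u where "u = frac (1 / t)"
  note gr = gauss_map[OF ge2.prems, folded t_def]
  note gt = gauss_map[OF gr(1-3), folded u_def]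
  define v where "v = cf_value (map (gauss_digit u) [0..<n])"
  have "cf_value (map (gauss_digit r) [0..<Suc (Suc n)])
      = 1 / (real (gauss_digit r 0) + 1 / (real (gauss_digit t 0) + v))"
    unfolding cf_value_map_Suc gauss_digit_Suc t_def[symmetric] u_def[symmetric] v_def ..
  moreover have "r = 1 / (real (gauss_digit r 0) + 1 / (real (gauss_digit t 0) + u))"
    using gr(5) gt(5) by simp
  moreover have "0 \<le> v" unfolding v_def using gauss_digit_pos[OF gt(1-3)] by (auto intro!: cf_value_bounds)
  ultimately have "\<bar>r - cf_value (map (gauss_digit r) [0..<Suc (Suc n)])\<bar> \<le> \<bar>u - v\<bar> / 4"
    using two_step_contraction[of "gauss_digit r 0" "gauss_digit t 0" u v] gr(4) gt(2,4) by simp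
  moreover have "\<bar>u - v\<bar> \<le> 2 * (1 / 2) ^ n" unfolding v_def by (rule ge2.IH(1)[OF gt(1-3)])
  ultimately show ?case by simp
qed

lemma infinite_cf_expansion_gauss_digit:
  assumes "r \<notin> \<rat>" "0 < r" "r < 1"
  shows "infinite_cf_expansion r (gauss_digit r)"
proof -
  have "(\<lambda>n. 2 * (1 / 2) ^ n :: real) \<longlonglongrightarrow> 2 * 0"
    by (intro tendsto_intros LIMSEQ_power_zero) simp
  then have "(\<lambda>n. cf_value (map (gauss_digit r) [0..<n]) - r) \<longlonglongrightarrow> 0"
    unfolding mult_zero_right
    by (rule tendsto_0_le[where K = 1])
      (use gauss_digit_convergent_bound[OF assms] in \<open>simp add: abs_minus_commute\<close>)
  then show ?thesis
    using gauss_digit_pos[OF assms] by (simp add: infinite_cf_expansion_def LIM_zero_iff)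
qed

section \<open>Recursion for the encoding and its strict monotonicity\<close>

lemma C_irrational:
  assumes "infinite_cf_expansion r g" "r \<notin> \<rat>"
  shows "C r = encode_infinite g"
  using assms infinite_cf_expansion_unique by (auto simp: C_def intro!: arg_cong[of _ _ encode_infinite])

text \<open>One recursion for rationals and irrationals, so that the final comparison needs no case
  split on rationality.\<close>

lemma C_unfold:
  assumes "0 < r" "r < 1"
  obtains b c u where "0 < b" "0 < c" "0 \<le> u" "u < 1"
    "r = 1 / (real b + 1 / (real c + u))" "C r = C_I b @- C_II c @- C u"
proof (cases "r \<in> \<rat>")
  case True
  then obtain bs where bs: "even_cf_expansion r bs" using even_cf_expansion_exists assms by force
  then have "bs \<noteq> []" "even (length bs)" using assms by (auto simp: even_cf_expansion_def)
  then obtain b c ds where bcds: "bs = b # c # ds"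
    by (cases bs; cases "tl bs") auto
  have rational: "cf_value xs \<in> \<rat>" for xs by (induction xs) auto
  have ds: "even_cf_expansion (cf_value ds) ds" and pos: "0 < b" "0 < c"
    and r: "r = 1 / (real b + 1 / (real c + cf_value ds))"
    using bs bcds by (auto simp: even_cf_expansion_def)
  have "C r = C_I b @- C_II c @- C (cf_value ds)"
    using C_rational[OF bs True] C_rational[OF ds rational] bcds encode_finite_unfold by simp
  then show ?thesis
    using that pos r ds cf_value_bounds(1)[of ds] even_cf_value_less_one[of ds]
    by (auto simp: even_cf_expansion_def)
next
  case False
  define g where "g = gauss_digit r"
  have g: "infinite_cf_expansion r g"
    unfolding g_def by (rule infinite_cf_expansion_gauss_digit[OF False assms])
  obtain u where u: "u \<notin> \<rat>" "0 \<le> u" "u < 1" "r = 1 / (real (g 0) + 1 / (real (g 1) + u))"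
    "infinite_cf_expansion u (\<lambda>i. g (Suc (Suc i)))"
    using infinite_cf_expansion_two_step[OF False g] .
  have "C r = C_I (g 0) @- C_II (g 1) @- C u"
    using C_irrational[OF g False] C_irrational[OF u(5,1)] encode_infinite_unfold[of g] by simp
  then show ?thesis
    using that g u by (auto simp: infinite_cf_expansion_def)
qed

text \<open>Each time both blocks agree, the gap between the remainders is at least 4 times the
  previous gap. For \<open>n = 0\<close> the gap would be at least 1, impossible inside [0, 1).
  Admitting \<open>r = 0\<close> makes the claim applicable to remainders.\<close>

lemma C_strict_mono_if_separated:
  assumes "0 \<le> r" "r < r'" "r' < 1" "(1 / 4) ^ n \<le> r' - r"
  shows "lex_less (C r) (C r')"
  using assms
proof (induction n arbitrary: r r')
  case 0
  then show ?case by simp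
next
  case (Suc n)
  obtain b' c' u' where w': "0 < b'" "0 < c'" "0 \<le> u'" "u' < 1"
    "r' = 1 / (real b' + 1 / (real c' + u'))" "C r' = C_I b' @- C_II c' @- C u'"
    using C_unfold[of r'] Suc.prems by auto
  show ?case
  proof (cases "r = 0")
    case True
    then show ?thesis using C_zero w'(6) aleph0_lex_less_C_I by simp
  next
    case False
    then obtain b c u where w: "0 < b" "0 < c" "0 \<le> u" "u < 1"
      "r = 1 / (real b + 1 / (real c + u))" "C r = C_I b @- C_II c @- C u"
      using C_unfold[of r] Suc.prems by auto
    have "b' < b \<or> b = b' \<and> (c < c' \<or> c = c' \<and> u \<le> u')"
      using w w' Suc.prems(2) by (intro two_step_le_cases) auto
    then consider "b' < b" | "b = b'" "c < c'" | "b = b'" "c = c'" "u \<le> u'" by blast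
    then show ?thesis
    proof cases
      case 1
      then show ?thesis using w w' C_I_strict_antimono list_lex_less_shift by simp
    next
      case 2
      then show ?thesis using w w' C_II_strict_mono list_lex_less_shift lex_less_shift by simp
    next
      case 3
      have "\<bar>r' - r\<bar> \<le> \<bar>u' - u\<bar> / 4"
        using two_step_contraction[of b c u' u] w w' 3 by simp
      then have "(1 / 4) ^ n \<le> u' - u" using Suc.prems(2,4) 3(3) by simp
      moreover from this have "u < u'" using zero_less_power[of "1 / 4 :: real" n] by linarith
      ultimately have "lex_less (C u) (C u')" using Suc.IH w w' by blast
      then show ?thesis using w w' 3 lex_less_shift by simp
    qed
  qed
qed

theorem mainTheorem2:
  fixes r r' :: real
  assumes "r \<in> {0<..<1}" and "r' \<in> {0<..<1}" and "r < r'"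
  shows "lex_less (C r) (C r')"
proof -
  obtain n where "(1 / 4 :: real) ^ n < r' - r"
    using real_arch_pow_inv[of "r' - r" "1 / 4"] assms(3) by auto
  then show ?thesis using C_strict_mono_if_separated[of r r' n] assms by simp
qed

end
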